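(* Let $g_1(x)$ and $g_2(x)$ be probability densities with respect to a measure $d\mu$, and let $\delta>0$. If $D[g_1(x)\,|\,g_2(x)]\le\delta$, then $$Er[g_1(x)\,|\,g_2(x)]\ \ge\ \min\{\,t \mid (x,t)\in A(\delta)\,\},$$ where $$A(\delta)= \Bigl\{ (x,t)\ \Big|\ x\log\Bigl(\frac{1-2t}{x} + 1\Bigr)+(1-x) \log\Bigl(\frac{2t-1}{1-x}+1\Bigr) = -\delta,\quad 0< x < 2t < 1\Bigr\}.$$
   Context: $D[g_1(x)\,|\,g_2(x)]=\int g_1(x)\log\bigl(g_1(x)/g_2(x)\bigr)d\mu$ is the Kullback–Leibler divergence. The Bayes error rate between $g_1$ and $g_2$ is $$Er[g_1(x)\,|\,g_2(x)]=\frac12\int\min\bigl(g_1(x),g_2(x)\bigr)\,d\mu .$$ In the definition of $A(\delta)$, $(x,t)$ is a pair of real numbers. *)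

theory Defs
  imports "HOL-Analysis.Analysis"
begin

definition prob_dens :: "'a measure \<Rightarrow> ('a \<Rightarrow> real) \<Rightarrow> bool" where
  "prob_dens M g \<longleftrightarrow>
     g \<in> borel_measurable M \<and> (\<forall>x\<in>space M. 0 \<le> g x) \<and> (\<integral>\<^sup>+ x. ennreal (g x) \<partial>M) = 1"

text \<open>
  The value of \<open>a log (a / b)\<close> for \<open>a, b \<ge> 0\<close>, with the usual conventions
  \<open>0 log (0 / b) = 0\<close> and \<open>a log (a / 0) = \<infinity>\<close> for \<open>a > 0\<close>. These have to be spelled out
  because HOL has \<open>a / 0 = 0\<close> and \<open>ln 0 = 0\<close>.
\<close>

definition KL_term :: "real \<Rightarrow> real \<Rightarrow> ereal" where
  "KL_term a b = (if a = 0 then 0 else if b = 0 then \<infinity> else ereal (a * ln (a / b)))"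

text \<open>
  The divergence may be infinite, so the integral of \<open>KL_term\<close> is taken in the extended
  reals, as positive part minus negative part; \<open>e2ennreal\<close> maps negative numbers to 0.
  (The Bochner integral would give 0 for a divergent integral, and so does the library's
  \<open>KL_divergence\<close>.) For probability densities the negative part is always finite, because
  \<open>- a log (a / b) \<le> b - a \<le> b\<close>, so the difference is never \<open>\<infinity> - \<infinity>\<close>.
\<close>

definition KL_div :: "'a measure \<Rightarrow> ('a \<Rightarrow> real) \<Rightarrow> ('a \<Rightarrow> real) \<Rightarrow> ereal" where
  "KL_div M g1 g2 =
     enn2ereal (\<integral>\<^sup>+ x. e2ennreal (KL_term (g1 x) (g2 x)) \<partial>M)
     - enn2ereal (\<integral>\<^sup>+ x. e2ennreal (- KL_term (g1 x) (g2 x)) \<partial>M)"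

definition bayes_error :: "'a measure \<Rightarrow> ('a \<Rightarrow> real) \<Rightarrow> ('a \<Rightarrow> real) \<Rightarrow> real" where
  "bayes_error M g1 g2 = 1 / 2 * (\<integral>x. min (g1 x) (g2 x) \<partial>M)"

definition A_set :: "real \<Rightarrow> (real \<times> real) set" where
  "A_set \<delta> = {(x, t).
     x * ln ((1 - 2 * t) / x + 1) + (1 - x) * ln ((2 * t - 1) / (1 - x) + 1) = - \<delta> \<and>
     0 < x \<and> x < 2 * t \<and> 2 * t < 1}"

end

theory Submission
  imports Defs "HOL-Real_Asymp.Real_Asymp"
begin

text \<open>
  Write \<open>V = 1 - \<integral> min g1 g2\<close> for the total variation distance, so that the Bayes error is
  \<open>(1 - V) / 2\<close>. Coarse-graining to the two cells \<open>B = {g1 < g2}\<close> and its complement does not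
  increase the divergence and keeps \<open>V\<close>: if \<open>p\<close> and \<open>q\<close> are the masses that \<open>g1\<close> and \<open>g2\<close>
  give to \<open>B\<close>, then \<open>q - p = V\<close>, and the divergence \<open>d(p, q)\<close> of the two Bernoulli laws is at
  most \<open>\<delta>\<close>. With \<open>s = 1 - 2 t\<close>, the pairs in \<open>A(\<delta>)\<close> are the solutions of
  \<open>d(x, x + s) = \<delta>\<close> with \<open>0 < x\<close>, \<open>0 < s\<close> and \<open>x + s < 1\<close>. Thus the claim is that the set of
  gaps \<open>s\<close> occurring in such solutions has a greatest element and that \<open>V\<close> does not exceed it.

  The two-cell inequality is obtained in its dual form: integrating the tangent bound
  \<open>a log (a / b) \<ge> a (1 + log c) - c b\<close>, with one constant \<open>c > 0\<close> on each cell, bounds the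
  divergence from below for every choice of the two constants
  (\<open>two_cell_bound_le_KL_div\<close>). Only afterwards are the constants optimised
  (\<open>binary_KL_le_if_affine_bounds\<close>), so empty cells and an infinite divergence become limits in
  real constants.

  Increasing \<open>q\<close> at fixed \<open>p\<close> towards 1 takes \<open>d(p, q)\<close> continuously to \<open>\<infinity>\<close>, so any pair \<open>p < q < 1\<close>
  with \<open>d(p, q) \<le> \<delta>\<close> can be widened to one with \<open>d(p, q') = \<delta>\<close>. This fails to give a point of
  \<open>A(\<delta>)\<close> only for \<open>p = 0\<close>; but there the slope of \<open>x \<mapsto> d(x, x + s)\<close> is \<open>-\<infinity>\<close>, so a
  small shift to \<open>x > 0\<close> makes the divergence smaller and leaves room for a strictly larger gap
  (\<open>ex_KL_gap_ge\<close>). The same remark repairs compactness (\<open>KL_gaps_has_greatest\<close>): the solutions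
  with gap bounded below stay away from \<open>x + s = 1\<close>, hence form a compact set once \<open>x = 0\<close> is
  added, and the greatest gap cannot occur at \<open>x = 0\<close>.
\<close>

section \<open>The divergence of two Bernoulli laws\<close>

text \<open>
  The four logarithms are kept apart because the convention \<open>0 log 0 = 0\<close> then makes the formula
  correct and continuous at \<open>p = 0\<close> and \<open>p = 1\<close>.
\<close>

definition binary_KL :: "real \<Rightarrow> real \<Rightarrow> real" where
  "binary_KL p q = p * ln p + (1 - p) * ln (1 - p) - p * ln q - (1 - p) * ln (1 - q)"

lemma A_set_iff_binary_KL:
  "(x, t) \<in> A_set \<delta> \<longleftrightarrow>
     0 < x \<and> x < 2 * t \<and> 2 * t < 1 \<and> binary_KL x (x + (1 - 2 * t)) = \<delta>"
proof (cases "0 < x \<and> x < 2 * t \<and> 2 * t < 1")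
  case True
  then have x: "0 < x" "x < 1" "x < 2 * t" "2 * t < 1" by auto
  have "(1 - 2 * t) / x + 1 = (x + (1 - 2 * t)) / x"
    and "(2 * t - 1) / (1 - x) + 1 = (1 - (x + (1 - 2 * t))) / (1 - x)"
    using x by (auto simp: field_simps)
  then have "x * ln ((1 - 2 * t) / x + 1) + (1 - x) * ln ((2 * t - 1) / (1 - x) + 1)
      = - binary_KL x (x + (1 - 2 * t))"
    using x by (simp add: binary_KL_def ln_div right_diff_distrib)
  then show ?thesis using True by (auto simp: A_set_def)
qed (auto simp: A_set_def)

lemma continuous_on_x_ln_x: "continuous_on {0..} (\<lambda>x::real. x * ln x)"
  unfolding continuous_on_def
proof
  fix x :: real assume "x \<in> {0..}"
  show "((\<lambda>x. x * ln x) \<longlongrightarrow> x * ln x) (at x within {0..})"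
  proof (cases "x = 0")
    case True
    have "((\<lambda>x::real. x * ln x) \<longlongrightarrow> 0) (at_right 0)" by real_asymp
    moreover have "at (0::real) within {0..} = at_right 0"
      by (rule at_within_Ici_at_right)
    ultimately show ?thesis using True by simp
  next
    case False
    then show ?thesis by (auto intro!: tendsto_intros)
  qed
qed

lemma continuous_on_binary_KL [continuous_intros]:
  assumes f: "continuous_on S f" and g: "continuous_on S g"
    and range: "\<And>z. z \<in> S \<Longrightarrow> 0 \<le> f z \<and> f z \<le> 1 \<and> 0 < g z \<and> g z < 1"
  shows "continuous_on S (\<lambda>z. binary_KL (f z) (g z))"
proof -
  have "continuous_on S (\<lambda>z. f z * ln (f z))"
    by (rule continuous_on_compose2[OF continuous_on_x_ln_x f]) (use range in force)
  moreover have "continuous_on S (\<lambda>z. (1 - f z) * ln (1 - f z))"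
    by (rule continuous_on_compose2[OF continuous_on_x_ln_x, of _ "\<lambda>z. 1 - f z"])
       (use range in \<open>force intro!: continuous_intros f\<close>)+
  moreover have "continuous_on S (\<lambda>z. f z * ln (g z))"
    and "continuous_on S (\<lambda>z. (1 - f z) * ln (1 - g z))"
    by (intro continuous_on_mult continuous_on_ln continuous_on_diff continuous_on_const f g;
        use range in force)+
  ultimately show ?thesis
    unfolding binary_KL_def by (intro continuous_on_diff continuous_on_add)
qed

text \<open>
  A crude bound (\<open>x log x \<ge> x - 1\<close> replaces the entropy), whose point is that it blows up as
  \<open>q\<close> tends to 1.
\<close>

lemma binary_KL_ge:
  assumes "0 \<le> p" "p < 1" "0 < q" "q < 1"
  shows "- 1 - (1 - p) * ln (1 - q) \<le> binary_KL p q"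
proof -
  have x_ln_x: "x - 1 \<le> x * ln x" if "0 \<le> x" for x :: real
  proof (cases "x = 0")
    case False
    then have "x * (1 - 1 / x) \<le> x * ln x"
      using that ln_le_minus_one[of "1 / x"] by (intro mult_left_mono) (auto simp: ln_div)
    then show ?thesis using False by (simp add: algebra_simps)
  qed simp
  have "p * ln q \<le> 0" using assms by (simp add: mult_nonneg_nonpos)
  then show ?thesis
    using x_ln_x[of p] x_ln_x[of "1 - p"] assms unfolding binary_KL_def by linarith
qed

text \<open>
  The bound is uniform in \<open>p\<close>: a gap of at least \<open>s\<close> forces \<open>1 - p \<ge> s\<close>, which keeps the weight
  of the divergent term \<open>- ln (1 - q)\<close> away from 0. This is what makes sublevel sets compact.
\<close>

lemma binary_KL_le_imp_bounded_away:
  assumes "0 \<le> p" "0 < s" "p + s \<le> q" "q < 1" "binary_KL p q \<le> \<delta>" "0 < \<delta>"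
  shows "q \<le> 1 - exp (- (1 + \<delta>) / s)"
proof -
  have "- ln (1 - q) * s \<le> - ln (1 - q) * (1 - p)"
    using assms by (intro mult_left_mono) auto
  also have "\<dots> \<le> 1 + \<delta>"
    using binary_KL_ge[of p q] assms by (simp add: mult.commute)
  finally have "- (1 + \<delta>) / s \<le> ln (1 - q)"
    using assms by (simp add: field_simps)
  then show ?thesis using assms by (simp add: ln_ge_iff)
qed

lemma ex_binary_KL_eq_above:
  assumes p: "0 < p" and q: "p \<le> q" "q < 1" and le: "binary_KL p q \<le> \<delta>" and "0 < \<delta>"
  obtains q' where "q \<le> q'" "q' < 1" "binary_KL p q' = \<delta>"
proof -
  \<comment> \<open>The second argument of the maximum is where the lower bound of \<open>binary_KL_ge\<close> reaches \<open>\<delta>\<close>.\<close>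
  define r where "r = max q (1 - exp (- (1 + \<delta>) / (1 - p)))"
  have r: "q \<le> r" "r < 1" using q by (auto simp: r_def)
  have "- (1 + \<delta>) / (1 - p) \<ge> ln (1 - r)"
  proof -
    have "1 - r \<le> exp (- (1 + \<delta>) / (1 - p))" by (simp add: r_def)
    then show ?thesis using r ln_le_cancel_iff[of "1 - r" "exp (- (1 + \<delta>) / (1 - p))"] by simp
  qed
  then have "(1 - p) * ln (1 - r) \<le> - (1 + \<delta>)"
    using p q by (simp add: field_simps)
  then have "\<delta> \<le> binary_KL p r"
    using binary_KL_ge[of p r] p q r by linarith
  moreover have "continuous_on {q..r} (binary_KL p)"
    using p q r by (intro continuous_on_binary_KL continuous_intros) auto
  ultimately obtain q' where "q \<le> q'" "q' \<le> r" "binary_KL p q' = \<delta>"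
    using IVT'[of "binary_KL p" q \<delta> r] le r by auto
  then show ?thesis using that r by auto
qed

text \<open>
  The term \<open>p ln p\<close> has slope \<open>-\<infinity>\<close> at 0 and all other terms have a finite slope there.
\<close>

lemma binary_KL_shift_less_at_0:
  assumes "0 < s" "s < 1"
  obtains p where "0 < p" "p + s < 1" "binary_KL p (p + s) < binary_KL 0 s"
proof -
  have "filterlim (\<lambda>p. (binary_KL p (p + s) - binary_KL 0 s) / p) at_bot (at_right 0)"
    unfolding binary_KL_def using assms by real_asymp
  then have "\<forall>\<^sub>F p in at_right 0. (binary_KL p (p + s) - binary_KL 0 s) / p < 0"
    by (simp add: filterlim_at_bot_dense)
  moreover have "\<forall>\<^sub>F p in at_right 0. p < 1 - s"
    using assms by (intro eventually_at_rightI[of 0 "1 - s"]) auto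
  moreover have "\<forall>\<^sub>F p in at_right 0. (0::real) < p"
    by (rule eventually_at_right_less)
  ultimately have "\<forall>\<^sub>F p in at_right 0.
      0 < p \<and> p + s < 1 \<and> binary_KL p (p + s) < binary_KL 0 s"
    by eventually_elim (auto simp: divide_less_0_iff)
  then show ?thesis
    using that eventually_happens'[OF trivial_limit_at_right_real] by blast
qed

section \<open>The greatest gap at a given divergence\<close>

definition KL_gaps :: "real \<Rightarrow> real set" where
  "KL_gaps \<delta> = {s. 0 < s \<and> (\<exists>p. 0 < p \<and> p + s < 1 \<and> binary_KL p (p + s) = \<delta>)}"

lemma A_set_snd_iff_KL_gaps: "(\<exists>x. (x, t) \<in> A_set \<delta>) \<longleftrightarrow> 1 - 2 * t \<in> KL_gaps \<delta>"
  by (auto simp: A_set_iff_binary_KL KL_gaps_def algebra_simps)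

text \<open>
  Raising \<open>q\<close> until the divergence equals \<open>\<delta>\<close> can only widen the gap, and widens it strictly
  when there was slack. A pair with \<open>p = 0\<close> gets such slack from a small shift to the right.
\<close>

lemma ex_KL_gap_ge:
  assumes "0 \<le> p" "0 \<le> s" "0 < p \<or> 0 < s" "p + s < 1" "binary_KL p (p + s) \<le> \<delta>" "0 < \<delta>"
  obtains s' where "s' \<in> KL_gaps \<delta>" "s \<le> s'" "p = 0 \<Longrightarrow> s < s'"
proof -
  have pos: "\<exists>s' \<in> KL_gaps \<delta>. s \<le> s' \<and> (binary_KL p (p + s) < \<delta> \<longrightarrow> s < s')"
    if p: "0 < p" "p + s < 1" "binary_KL p (p + s) \<le> \<delta>" for p
  proof -
    obtain q' where q': "p + s \<le> q'" "q' < 1" "binary_KL p q' = \<delta>"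
      using ex_binary_KL_eq_above[of p "p + s" \<delta>] p assms by auto
    then have strict: "binary_KL p (p + s) < \<delta> \<longrightarrow> s < q' - p"
      by (cases "q' = p + s") auto
    have "binary_KL p p = 0" by (simp add: binary_KL_def)
    then have "0 < q' - p" using strict q'(1) assms by (cases "s = 0") auto
    then have "q' - p \<in> KL_gaps \<delta>"
      using p q' unfolding KL_gaps_def by (auto intro!: exI[of _ p])
    then show ?thesis using strict q' by (intro bexI[of _ "q' - p"]) auto
  qed
  show ?thesis
  proof (cases "p = 0")
    case True
    then obtain p' where "0 < p'" "p' + s < 1" "binary_KL p' (p' + s) < \<delta>"
      using binary_KL_shift_less_at_0[of s] assms by (metis add_0 order_less_le_trans)
    then show ?thesis using pos[of p'] that by (metis less_imp_le)
  next
    case False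
    then show ?thesis using pos[of p] assms that by (metis order_le_less)
  qed
qed

text \<open>
  Gaps below a known one \<open>s0\<close> are irrelevant, and the solutions with gap at least \<open>s0\<close>, together
  with their limits at \<open>p = 0\<close>, form a compact set. A greatest gap attained at \<open>p = 0\<close> could be
  widened by a shift, so it is attained at some \<open>p > 0\<close>.
\<close>

lemma KL_gaps_has_greatest:
  assumes "0 < \<delta>"
  obtains s where "s \<in> KL_gaps \<delta>" "\<And>s'. s' \<in> KL_gaps \<delta> \<Longrightarrow> s' \<le> s"
proof -
  \<comment> \<open>Widening two equal fair laws shows that there are gaps at all.\<close>
  have "binary_KL (1 / 2) (1 / 2) = 0" by (simp add: binary_KL_def)
  then obtain s0 where s0: "s0 \<in> KL_gaps \<delta>"
    using ex_KL_gap_ge[of "1 / 2" 0 \<delta>] assms by auto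
  then have "0 < s0" by (simp add: KL_gaps_def)
  define e where "e = exp (- (1 + \<delta>) / s0)"
  define T where "T = {z :: real \<times> real. 0 \<le> fst z \<and> s0 \<le> snd z \<and> fst z + snd z \<le> 1 - e}"
  define K where "K = {z \<in> T. binary_KL (fst z) (fst z + snd z) = \<delta>}"
  have "0 < e" by (simp add: e_def)
  have "closed T"
    unfolding T_def by (intro closed_Collect_conj closed_Collect_le continuous_intros)
  moreover have "continuous_on T (\<lambda>z. binary_KL (fst z) (fst z + snd z))"
    using \<open>0 < e\<close> \<open>0 < s0\<close> by (intro continuous_intros) (auto simp: T_def)
  ultimately have "closed K"
    unfolding K_def by (intro continuous_closed_preimage_constant)
  moreover have "K \<subseteq> {0..1} \<times> {0..1}"
    using \<open>0 < e\<close> \<open>0 < s0\<close> by (auto simp: K_def T_def)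
  then have "bounded K"
    by (rule bounded_subset[rotated]) (intro bounded_Times bounded_closed_interval)
  ultimately have "compact K" by (simp add: compact_eq_bounded_closed)
  have gaps_K: "\<exists>p. (p, s) \<in> K" if s: "s \<in> KL_gaps \<delta>" "s0 \<le> s" for s
  proof -
    obtain p where p: "0 < p" "p + s < 1" "binary_KL p (p + s) = \<delta>"
      using s(1) by (auto simp: KL_gaps_def)
    then have "p + s \<le> 1 - e"
      unfolding e_def using s \<open>0 < s0\<close> assms by (intro binary_KL_le_imp_bounded_away[of p]) auto
    then have "(p, s) \<in> K" using p s by (simp add: K_def T_def)
    then show ?thesis ..
  qed
  have "K \<noteq> {}" using gaps_K[OF s0] by auto
  have "continuous_on K snd" by (intro continuous_intros)
  then obtain z where z: "z \<in> K" and max: "\<And>y. y \<in> K \<Longrightarrow> snd y \<le> snd z"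
    using continuous_attains_sup[OF \<open>compact K\<close> \<open>K \<noteq> {}\<close>] by blast
  obtain p s where ps: "z = (p, s)" by (cases z)
  have in_K: "0 \<le> p" "s0 \<le> s" "p + s < 1" "binary_KL p (p + s) = \<delta>"
    using z \<open>0 < e\<close> by (auto simp: ps K_def T_def)
  have greatest: "s' \<le> s" if "s' \<in> KL_gaps \<delta>" for s'
    using gaps_K[OF that] max in_K ps by (cases "s0 \<le> s'") force+
  have "p \<noteq> 0"
  proof
    assume "p = 0"
    then obtain s' where "s' \<in> KL_gaps \<delta>" "s < s'"
      using ex_KL_gap_ge[of p s \<delta>] in_K \<open>0 < s0\<close> assms by auto
    then show False using greatest by fastforce
  qed
  then have "s \<in> KL_gaps \<delta>"
    using in_K \<open>0 < s0\<close> by (auto simp: KL_gaps_def intro!: exI[of _ p])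
  then show ?thesis using greatest that by blast
qed

section \<open>Reduction to two cells\<close>

text \<open>
  This is \<open>ln y \<le> y - 1\<close> at \<open>y = c b / a\<close>: the tangent plane of the homogeneous convex function
  \<open>(a, b) \<mapsto> a ln (a / b)\<close> along the ray \<open>a = c b\<close>.
\<close>

lemma KL_term_ge_affine:
  assumes "0 \<le> a" "0 \<le> b" "0 < c"
  shows "ereal (a * (1 + ln c) - c * b) \<le> KL_term a b"
proof -
  have "a * (1 + ln c) - c * b \<le> a * ln (a / b)" if "0 < a" "0 < b"
  proof -
    have "ln (c * b / a) \<le> c * b / a - 1"
      using that assms by (intro ln_le_minus_one) auto
    then have "a * ln (c * b / a) \<le> a * (c * b / a - 1)"
      using that by (intro mult_left_mono) auto
    then show ?thesis
      using that assms by (simp add: ln_div ln_mult algebra_simps)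
  qed
  then show ?thesis using assms by (auto simp: KL_term_def)
qed

text \<open>
  Positive and negative parts are compared separately. The integrable minorant \<open>L\<close> makes the
  negative part of the divergence finite, so \<open>\<infinity> - \<infinity>\<close> does not occur.
\<close>

lemma integral_le_KL_div:
  assumes int: "integrable M L"
    and le: "\<And>x. x \<in> space M \<Longrightarrow> ereal (L x) \<le> KL_term (g1 x) (g2 x)"
  shows "ereal (\<integral>x. L x \<partial>M) \<le> KL_div M g1 g2"
proof -
  let ?P = "\<integral>\<^sup>+x. ennreal (L x) \<partial>M" and ?N = "\<integral>\<^sup>+x. ennreal (- L x) \<partial>M"
  have fin: "?P \<noteq> \<infinity>" "?N \<noteq> \<infinity>"
    using int by (auto simp: real_integrable_def)
  have "ereal (\<integral>x. L x \<partial>M) = ereal (enn2real ?P) - ereal (enn2real ?N)"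
    using int by (simp add: real_lebesgue_integral_def)
  also have "\<dots> = enn2ereal ?P - enn2ereal ?N"
    using fin by (cases ?P; cases ?N) auto
  also have "\<dots> \<le> KL_div M g1 g2"
    unfolding KL_div_def
  proof (intro ereal_minus_mono)
    have "?P \<le> (\<integral>\<^sup>+x. e2ennreal (KL_term (g1 x) (g2 x)) \<partial>M)"
    proof (intro nn_integral_mono)
      fix x assume "x \<in> space M"
      then show "ennreal (L x) \<le> e2ennreal (KL_term (g1 x) (g2 x))"
        using e2ennreal_mono[OF le] by simp
    qed
    then show "enn2ereal ?P \<le> enn2ereal (\<integral>\<^sup>+x. e2ennreal (KL_term (g1 x) (g2 x)) \<partial>M)"
      by (simp add: less_eq_ennreal.rep_eq)
    have "(\<integral>\<^sup>+x. e2ennreal (- KL_term (g1 x) (g2 x)) \<partial>M) \<le> ?N"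
    proof (intro nn_integral_mono)
      fix x assume "x \<in> space M"
      then have "- KL_term (g1 x) (g2 x) \<le> ereal (- L x)"
        using le by (simp add: ereal_uminus_le_reorder)
      then show "e2ennreal (- KL_term (g1 x) (g2 x)) \<le> ennreal (- L x)"
        using e2ennreal_mono by fastforce
    qed
    then show "enn2ereal (\<integral>\<^sup>+x. e2ennreal (- KL_term (g1 x) (g2 x)) \<partial>M) \<le> enn2ereal ?N"
      by (simp add: less_eq_ennreal.rep_eq)
  qed
  finally show ?thesis .
qed

lemma prob_densD:
  assumes "prob_dens M g"
  shows "integrable M g" "(\<integral>x. g x \<partial>M) = 1" "\<And>x. x \<in> space M \<Longrightarrow> 0 \<le> g x"
proof -
  show nn: "\<And>x. x \<in> space M \<Longrightarrow> 0 \<le> g x" using assms by (simp add: prob_dens_def)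
  have "has_bochner_integral M g 1"
    using assms nn by (intro has_bochner_integral_nn_integral) (auto simp: prob_dens_def)
  then show "integrable M g" "(\<integral>x. g x \<partial>M) = 1"
    by (auto simp: has_bochner_integral_iff)
qed

lemma integrable_prob_dens_on:
  assumes "prob_dens M g" "B \<in> sets M"
  shows "integrable M (\<lambda>x. indicator B x * g x)"
  using assms(2) prob_densD(1)[OF assms(1)] integrable_mult_indicator[of B M g] by simp

text \<open>
  The data processing inequality for the partition into \<open>B\<close> and its complement, in dual form: the
  supremum of the left-hand side over \<open>c\<close> and \<open>d\<close> is the divergence of the Bernoulli laws
  with parameters \<open>p\<close> and \<open>q\<close>.
\<close>

lemma two_cell_bound_le_KL_div:
  assumes g1: "prob_dens M g1" and g2: "prob_dens M g2" and B: "B \<in> sets M"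
    and c: "0 < c" "0 < d"
  defines "p \<equiv> \<integral>x. indicator B x * g1 x \<partial>M" and "q \<equiv> \<integral>x. indicator B x * g2 x \<partial>M"
  shows "ereal (p * (1 + ln c) - c * q + (1 - p) * (1 + ln d) - d * (1 - q)) \<le> KL_div M g1 g2"
proof -
  note D1 = prob_densD[OF g1] and D2 = prob_densD[OF g2]
  note int = integrable_prob_dens_on[OF g1 B] integrable_prob_dens_on[OF g2 B]
  define L where "L x = (1 + ln c) * (indicator B x * g1 x) - c * (indicator B x * g2 x)
      + (1 + ln d) * (g1 x - indicator B x * g1 x) - d * (g2 x - indicator B x * g2 x)" for x
  have "integrable M L" unfolding L_def using int D1(1) D2(1) by auto
  moreover have "ereal (L x) \<le> KL_term (g1 x) (g2 x)" if "x \<in> space M" for x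
    using KL_term_ge_affine[of "g1 x" "g2 x" c] KL_term_ge_affine[of "g1 x" "g2 x" d]
      c D1(3)[OF that] D2(3)[OF that]
    by (cases "x \<in> B") (auto simp: L_def algebra_simps)
  ultimately have "ereal (\<integral>x. L x \<partial>M) \<le> KL_div M g1 g2" by (rule integral_le_KL_div)
  moreover have "(\<integral>x. L x \<partial>M) = p * (1 + ln c) - c * q + (1 - p) * (1 + ln d) - d * (1 - q)"
    unfolding L_def p_def q_def using int D1(1,2) D2(1,2) by simp
  ultimately show ?thesis by simp
qed

text \<open>
  The optimal constants are the likelihood ratios \<open>p / q\<close> and \<open>(1 - p) / (1 - q)\<close> of the cells.
  For \<open>q = 1\<close> the second ratio is infinite, and for \<open>p = 0\<close> the first one is 0; these values are
  approached by admissible constants.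
\<close>

lemma binary_KL_le_if_affine_bounds:
  assumes pq: "0 \<le> p" "p < q" "q \<le> 1"
    and bound: "\<And>c d. 0 < c \<Longrightarrow> 0 < d \<Longrightarrow>
      p * (1 + ln c) - c * q + (1 - p) * (1 + ln d) - d * (1 - q) \<le> \<delta>"
  shows "q < 1" "binary_KL p q \<le> \<delta>"
proof -
  show q: "q < 1"
  proof (rule ccontr)
    assume "\<not> q < 1"
    with pq have "q = 1" by simp
    \<comment> \<open>The bound then reads \<open>p - 1 + (1 - p) (1 + ln d) \<le> \<delta>\<close>, and this \<open>d\<close> makes its left-hand side \<open>\<delta> + 1\<close>.\<close>
    then show False
      using bound[of 1 "exp ((\<delta> + 1) / (1 - p))"] pq by (simp add: field_simps)
  qed
  let ?d = "(1 - p) / (1 - q)"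
  have d: "0 < ?d" "ln ?d = ln (1 - p) - ln (1 - q)" "?d * (1 - q) = 1 - p"
    using pq q by (auto simp: ln_div)
  show "binary_KL p q \<le> \<delta>"
  proof (cases "p = 0")
    case True
    show ?thesis
    proof (rule field_le_epsilon)
      fix e :: real assume "0 < e"
      then have "e * q \<le> e" using q by simp
      then show "binary_KL p q \<le> \<delta> + e"
        using bound[OF \<open>0 < e\<close> d(1)] d(2,3) True by (simp add: binary_KL_def)
    qed
  next
    case False
    then have c: "0 < p / q" "ln (p / q) = ln p - ln q" "p / q * q = p"
      using pq by (auto simp: ln_div)
    show ?thesis
      using bound[OF c(1) d(1)] unfolding c(2,3) d(2,3) binary_KL_def
      by (simp add: algebra_simps)
  qed
qed

section \<open>The lower bound for the Bayes error\<close>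

theorem theorem2:
  fixes M :: "'a measure" and g1 g2 :: "'a \<Rightarrow> real" and \<delta> :: real
  assumes "prob_dens M g1" and "prob_dens M g2"
    and "\<delta> > 0"
    and "KL_div M g1 g2 \<le> ereal \<delta>"
  shows "\<exists>m. m \<in> {t. \<exists>x. (x, t) \<in> A_set \<delta>} \<and>
             (\<forall>t \<in> {t. \<exists>x. (x, t) \<in> A_set \<delta>}. m \<le> t) \<and>
             bayes_error M g1 g2 \<ge> m"
proof -
  note D1 = prob_densD[OF assms(1)] and D2 = prob_densD[OF assms(2)]
  note [measurable] = borel_measurable_integrable[OF D1(1)] borel_measurable_integrable[OF D2(1)]
  define B where "B = {x \<in> space M. g1 x < g2 x}"
  have B: "B \<in> sets M" unfolding B_def by measurable
  note int = integrable_prob_dens_on[OF assms(1) B] integrable_prob_dens_on[OF assms(2) B]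
  define p where "p = (\<integral>x. indicator B x * g1 x \<partial>M)"
  define q where "q = (\<integral>x. indicator B x * g2 x \<partial>M)"
  have "p \<le> q"
    unfolding p_def q_def using int
    by (intro integral_mono) (auto simp: B_def indicator_def)
  have "0 \<le> p"
    unfolding p_def using D1(3) by (intro integral_nonneg_AE) auto
  have "q \<le> (\<integral>x. g2 x \<partial>M)"
    unfolding q_def using int D2 by (intro integral_mono) (auto simp: indicator_def)
  then have "q \<le> 1" by (simp add: D2)
  have "(\<integral>x. min (g1 x) (g2 x) \<partial>M)
      = (\<integral>x. g2 x + indicator B x * g1 x - indicator B x * g2 x \<partial>M)"
    by (intro Bochner_Integration.integral_cong) (auto simp: B_def indicator_def)
  also have "\<dots> = 1 - (q - p)"
    unfolding p_def q_def using int D2(1,2) by simp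
  finally have err: "bayes_error M g1 g2 = (1 - (q - p)) / 2"
    by (simp add: bayes_error_def)
  obtain s where s: "s \<in> KL_gaps \<delta>" and greatest: "\<And>s'. s' \<in> KL_gaps \<delta> \<Longrightarrow> s' \<le> s"
    using KL_gaps_has_greatest[OF \<open>\<delta> > 0\<close>] by blast
  have "q - p \<le> s"
  proof (cases "p = q")
    case True
    then show ?thesis using s by (simp add: KL_gaps_def)
  next
    case False
    with \<open>p \<le> q\<close> have "p < q" by simp
    have "p * (1 + ln c) - c * q + (1 - p) * (1 + ln d) - d * (1 - q) \<le> \<delta>"
      if "0 < c" "0 < d" for c d
      using order_trans[OF two_cell_bound_le_KL_div[OF assms(1,2) B that] assms(4)]
      by (simp add: p_def q_def)
    from binary_KL_le_if_affine_bounds[OF \<open>0 \<le> p\<close> \<open>p < q\<close> \<open>q \<le> 1\<close> this]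
    have "q < 1" "binary_KL p q \<le> \<delta>" by auto
    then obtain s' where "s' \<in> KL_gaps \<delta>" "q - p \<le> s'"
      using ex_KL_gap_ge[of p "q - p" \<delta>] \<open>0 \<le> p\<close> \<open>p < q\<close> \<open>\<delta> > 0\<close> by auto
    then show ?thesis using greatest by force
  qed
  then have "bayes_error M g1 g2 \<ge> (1 - s) / 2" by (simp add: err)
  moreover have "(1 - s) / 2 \<in> {t. \<exists>x. (x, t) \<in> A_set \<delta>}"
    using s unfolding mem_Collect_eq A_set_snd_iff_KL_gaps by (simp add: diff_divide_distrib)
  moreover have "\<forall>t \<in> {t. \<exists>x. (x, t) \<in> A_set \<delta>}. (1 - s) / 2 \<le> t"
    unfolding mem_Collect_eq A_set_snd_iff_KL_gaps Ball_def using greatest by force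
  ultimately show ?thesis by blast
qed

end
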